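(* Let $X$ be a $T_0$ space and let $C(X)$ be the complete lattice of closed subsets of $X$ ordered by inclusion. Then: (1) $X$ is a continuous space iff $C(X)$ is a continuous lattice iff $C(X)$ is completely distributive. (2) $X$ is a quasicontinuous space iff $C(X)$ is a quasicontinuous lattice. (3) $X$ is an algebraic space iff $C(X)$ is an algebraic lattice. (4) $X$ is a quasialgebraic space iff $C(X)$ is a quasialgebraic lattice.
   Context: Order notions on a $T_0$ space refer to the specialization order $x\sqsubseteq y$ iff $x\in\overline{\{y\}}$; $\uparrow F=\{y:\exists x\in F,\ x\sqsubseteq y\}$; $(\cdot)^\circ$ is interior. A $T_0$ space $X$ is called: - continuous if it is a c-space: for every open $U$ and $y\in U$ there is $x\in U$ with $y\in(\uparrow x)^\circ$; - algebraic if it is a b-space: for every open $U$ and $x\in U$ there is $y\in U$ with $x\in(\uparrow y)^\circ=\uparrow y$; - quasicontinuous if it is locally hypercompact: for every open $U$ and $x\in U$ there is a finite $F\subseteq X$ with $x\in(\uparrow F)^\circ\subseteq\uparrow F\subseteq U$; - quasialgebraic if it is hypercompactly based: for every open $U$ and $x\in U$ there is a finite $F\subseteq X$ with $x\in(\uparrow F)^\circ=\uparrow F\subseteq U$. For a complete lattice $L$ and $G,H\subseteq L$, $G\ll H$ means: for every directed $D\subseteq L$ with $\bigvee D\in\uparrow H$ one has $D\cap\uparrow G\neq\emptyset$; $G\ll x$ means $G\ll\{x\}$. Finite sets are preordered by $G\le H$ iff $\uparrow H\subseteq\uparrow G$. $L$ is a quasicontinuous lattice if for each $x\in L$ the family of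 finite $F$ with $F\ll x$ is directed and $\uparrow x=\bigcap\{\uparrow F: F \text{ finite}, F\ll x\}$. $L$ is a quasialgebraic lattice if for each $x\in L$ the family of finite $F$ with $F\ll F$ and $x\in\uparrow F$ is directed and $\uparrow x$ is the intersection of the corresponding sets $\uparrow F$. Continuous and algebraic lattices are the standard notions of domain theory. *)

theory Defs
  imports "HOL-Analysis.Abstract_Topological_Spaces" "HOL-Algebra.Complete_Lattice"
begin

text \<open>HOL-Algebra's \<open>closure_of\<close> syntax clashes with the topological closure operator.\<close>

no_notation eq_closure_of (\<open>closure'_of\<index>\<close>)

section \<open>Upper sets and directed families\<close>

text \<open>Ordered structures are the records of \<^theory>\<open>HOL-Algebra.Order\<close>, so that
  a \<open>T\<^sub>0\<close> space with its specialization order and its lattice of closed sets share one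
  notion of upper set.\<close>

definition up_set :: "('a, 'b) gorder_scheme \<Rightarrow> 'a set \<Rightarrow> 'a set" where
  "up_set L G = {y \<in> carrier L. \<exists>x\<in>G. x \<sqsubseteq>\<^bsub>L\<^esub> y}"

definition directed_wrt :: "('a \<Rightarrow> 'a \<Rightarrow> bool) \<Rightarrow> 'a set \<Rightarrow> bool" where
  "directed_wrt R D \<longleftrightarrow> D \<noteq> {} \<and> (\<forall>x\<in>D. \<forall>y\<in>D. \<exists>z\<in>D. R x z \<and> R y z)"

text \<open>The preorder \<open>\<up>H \<subseteq> \<up>G\<close> on subsets (the Smyth preorder).\<close>

definition smyth_le :: "('a, 'b) gorder_scheme \<Rightarrow> 'a set \<Rightarrow> 'a set \<Rightarrow> bool" where
  "smyth_le L G H \<longleftrightarrow> up_set L H \<subseteq> up_set L G"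


section \<open>Classes of spaces\<close>

definition specialization :: "'a topology \<Rightarrow> 'a gorder" where
  "specialization X =
     \<lparr>carrier = topspace X, eq = (=), le = (\<lambda>x y. x \<in> X closure_of {y})\<rparr>"

abbreviation spec_up :: "'a topology \<Rightarrow> 'a set \<Rightarrow> 'a set" where
  "spec_up X F \<equiv> up_set (specialization X) F"

definition continuous_space :: "'a topology \<Rightarrow> bool" where
  "continuous_space X \<longleftrightarrow>
     (\<forall>U y. openin X U \<and> y \<in> U \<longrightarrow> (\<exists>x\<in>U. y \<in> X interior_of (spec_up X {x})))"

definition algebraic_space :: "'a topology \<Rightarrow> bool" where
  "algebraic_space X \<longleftrightarrow>
     (\<forall>U x. openin X U \<and> x \<in> U \<longrightarrow>
        (\<exists>y\<in>U. x \<in> X interior_of (spec_up X {y}) \<and> X interior_of (spec_up X {y}) = spec_up X {y}))"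

definition quasicontinuous_space :: "'a topology \<Rightarrow> bool" where
  "quasicontinuous_space X \<longleftrightarrow>
     (\<forall>U x. openin X U \<and> x \<in> U \<longrightarrow>
        (\<exists>F. finite F \<and> F \<subseteq> topspace X \<and> x \<in> X interior_of (spec_up X F) \<and> spec_up X F \<subseteq> U))"

definition quasialgebraic_space :: "'a topology \<Rightarrow> bool" where
  "quasialgebraic_space X \<longleftrightarrow>
     (\<forall>U x. openin X U \<and> x \<in> U \<longrightarrow>
        (\<exists>F. finite F \<and> F \<subseteq> topspace X \<and> x \<in> X interior_of (spec_up X F) \<and>
             X interior_of (spec_up X F) = spec_up X F \<and> spec_up X F \<subseteq> U))"


section \<open>Classes of complete lattices\<close>

definition set_way_below :: "('a, 'b) gorder_scheme \<Rightarrow> 'a set \<Rightarrow> 'a set \<Rightarrow> bool" where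
  "set_way_below L G H \<longleftrightarrow>
     (\<forall>D. D \<subseteq> carrier L \<and> directed_wrt (le L) D \<and> \<Squnion>\<^bsub>L\<^esub>D \<in> up_set L H \<longrightarrow>
        D \<inter> up_set L G \<noteq> {})"

definition way_below :: "('a, 'b) gorder_scheme \<Rightarrow> 'a \<Rightarrow> 'a \<Rightarrow> bool" where
  "way_below L x y \<longleftrightarrow> set_way_below L {x} {y}"

definition continuous_lattice :: "('a, 'b) gorder_scheme \<Rightarrow> bool" where
  "continuous_lattice L \<longleftrightarrow> complete_lattice L \<and>
     (\<forall>x\<in>carrier L.
        directed_wrt (le L) {y \<in> carrier L. way_below L y x} \<and>
        x = \<Squnion>\<^bsub>L\<^esub>{y \<in> carrier L. way_below L y x})"

definition algebraic_lattice :: "('a, 'b) gorder_scheme \<Rightarrow> bool" where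
  "algebraic_lattice L \<longleftrightarrow> complete_lattice L \<and>
     (\<forall>x\<in>carrier L.
        directed_wrt (le L) {k \<in> carrier L. way_below L k k \<and> k \<sqsubseteq>\<^bsub>L\<^esub> x} \<and>
        x = \<Squnion>\<^bsub>L\<^esub>{k \<in> carrier L. way_below L k k \<and> k \<sqsubseteq>\<^bsub>L\<^esub> x})"

definition fin_way_below :: "('a, 'b) gorder_scheme \<Rightarrow> 'a \<Rightarrow> 'a set set" where
  "fin_way_below L x = {F. finite F \<and> F \<subseteq> carrier L \<and> set_way_below L F {x}}"

definition fin_compact_below :: "('a, 'b) gorder_scheme \<Rightarrow> 'a \<Rightarrow> 'a set set" where
  "fin_compact_below L x =
     {F. finite F \<and> F \<subseteq> carrier L \<and> set_way_below L F F \<and> x \<in> up_set L F}"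

definition quasicontinuous_lattice :: "('a, 'b) gorder_scheme \<Rightarrow> bool" where
  "quasicontinuous_lattice L \<longleftrightarrow> complete_lattice L \<and>
     (\<forall>x\<in>carrier L.
        directed_wrt (smyth_le L) (fin_way_below L x) \<and>
        up_set L {x} = (\<Inter>F\<in>fin_way_below L x. up_set L F))"

definition quasialgebraic_lattice :: "('a, 'b) gorder_scheme \<Rightarrow> bool" where
  "quasialgebraic_lattice L \<longleftrightarrow> complete_lattice L \<and>
     (\<forall>x\<in>carrier L.
        directed_wrt (smyth_le L) (fin_compact_below L x) \<and>
        up_set L {x} = (\<Inter>F\<in>fin_compact_below L x. up_set L F))"

text \<open>The relativisation to a carrier of the axiom of the type class
  \<^class>\<open>complete_distrib_lattice\<close>, as an equation; the \<open>f\<close> are the choice functions of \<open>\<A>\<close>.\<close>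

definition completely_distributive :: "('a, 'b) gorder_scheme \<Rightarrow> bool" where
  "completely_distributive L \<longleftrightarrow> complete_lattice L \<and>
     (\<forall>\<A>. \<A> \<subseteq> Pow (carrier L) \<longrightarrow>
        \<Sqinter>\<^bsub>L\<^esub>((\<lambda>A. \<Squnion>\<^bsub>L\<^esub>A) ` \<A>) =
        \<Squnion>\<^bsub>L\<^esub>((\<lambda>B. \<Sqinter>\<^bsub>L\<^esub>B) ` {f ` \<A> | f. \<forall>A\<in>\<A>. f A \<in> A}))"


section \<open>The lattice of closed sets\<close>

definition closed_sets_lattice :: "'a topology \<Rightarrow> 'a set gorder" where
  "closed_sets_lattice X = \<lparr>carrier = {C. closedin X C}, eq = (=), le = (\<subseteq>)\<rparr>"

lemma partial_order_specialization:
  assumes "t0_space X"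
  shows "partial_order (specialization X)"
proof -
  have refl: "x \<in> X closure_of {x}" if "x \<in> topspace X" for x
    using that by (simp add: in_closure_of)
  have anti: "x = y" if xy: "x \<in> X closure_of {y}" "y \<in> X closure_of {x}" for x y
  proof (rule ccontr)
    assume "x \<noteq> y"
    moreover have "x \<in> topspace X" "y \<in> topspace X"
      using xy by (simp_all add: in_closure_of)
    ultimately obtain U where U: "openin X U" "x \<notin> U \<longleftrightarrow> y \<in> U"
      using assms unfolding t0_space_def by metis
    then show False
      using xy by (cases "x \<in> U") (auto simp: in_closure_of)
  qed
  have trans: "x \<in> X closure_of {z}" if "x \<in> X closure_of {y}" "y \<in> X closure_of {z}" for x y z
  proof -
    have "X closure_of {y} \<subseteq> X closure_of {z}"
      using that(2) by (intro closure_of_minimal) auto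
    with that(1) show ?thesis by (rule subsetD[rotated])
  qed
  show ?thesis
  proof
    show "x \<sqsubseteq>\<^bsub>specialization X\<^esub> x" if "x \<in> carrier (specialization X)" for x
      using that refl by (simp add: specialization_def)
    show "x .=\<^bsub>specialization X\<^esub> y"
      if "x \<sqsubseteq>\<^bsub>specialization X\<^esub> y" "y \<sqsubseteq>\<^bsub>specialization X\<^esub> x" for x y
      using that anti by (simp add: specialization_def)
    show "x \<sqsubseteq>\<^bsub>specialization X\<^esub> z"
      if "x \<sqsubseteq>\<^bsub>specialization X\<^esub> y" "y \<sqsubseteq>\<^bsub>specialization X\<^esub> z" for x y z
      using that trans[of x y z] by (simp add: specialization_def)
  qed (simp_all add: specialization_def)
qed

lemma complete_lattice_closed_sets: "complete_lattice (closed_sets_lattice X)"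
proof -
  let ?L = "closed_sets_lattice X"
  interpret partial_order ?L
    by unfold_locales (auto simp: closed_sets_lattice_def)
  show ?thesis
  proof (rule complete_latticeI)
    fix A assume "A \<subseteq> carrier ?L"
    then have A: "closedin X B" if "B \<in> A" for B
      using that by (auto simp: closed_sets_lattice_def)
    then have "\<Union>A \<subseteq> topspace X"
      by (meson Sup_least closedin_subset)
    then have "\<Union>A \<subseteq> X closure_of (\<Union>A)"
      by (rule closure_of_subset)
    then have "B \<subseteq> X closure_of (\<Union>A)" if "B \<in> A" for B
      using that by (meson Sup_upper order_trans)
    moreover have "X closure_of (\<Union>A) \<subseteq> C" if "closedin X C" "\<forall>B\<in>A. B \<subseteq> C" for C
      using that by (intro closure_of_minimal Sup_least) simp_all
    ultimately have "least ?L (X closure_of (\<Union>A)) (Upper ?L A)"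
      using A by (simp add: least_def Upper_def closed_sets_lattice_def Collect_mono_iff Int_def)
    then show "\<exists>s. least ?L s (Upper ?L A)" ..
    have "greatest ?L (if A = {} then topspace X else \<Inter>A) (Lower ?L A)"
    proof (cases "A = {}")
      case True
      then show ?thesis
        by (simp add: greatest_def Lower_def closed_sets_lattice_def closedin_subset)
    next
      case False
      then have "closedin X (\<Inter>A)"
        using A by (intro closedin_Inter) simp_all
      with False A show ?thesis
        by (simp add: greatest_def Lower_def closed_sets_lattice_def Inf_lower Inf_greatest
            Collect_mono_iff Int_def)
    qed
    then show "\<exists>i. greatest ?L i (Lower ?L A)" ..
  qed
qed

end

theory Submission
  imports Defs
begin

text \<open>The way-below relation of \<open>C(X)\<close> is governed by two facts. If \<open>\<F> \<ll> \<H>\<close> and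
  an upper set \<open>T\<close> meets every member of \<open>\<F>\<close>, then its interior meets every member of
  \<open>\<H>\<close>: otherwise some \<open>H \<in> \<H>\<close> lies in the closure of the complement of \<open>T\<close>, which
  is the directed supremum of the finitely generated lower sets avoiding \<open>T\<close>. Conversely, if the
  interior of \<open>\<up>F\<close> meets every member of \<open>\<H>\<close>, then the family of point closures of
  \<open>F\<close> is way below \<open>\<H>\<close>. Applied to \<open>\<F> \<ll> cl{x}\<close> and a finite transversal
  \<open>F\<close> of \<open>\<F>\<close> inside an open set, this settles the (quasi)continuous cases. In the
  (quasi)algebraic cases \<open>\<F>\<close> is compact, so the transversals may be taken from a fixed finite
  set of generators, and the interior of \<open>\<up>F\<close> is again the neighbourhood of such a
  transversal; hence a transversal with minimal \<open>\<up>F\<close> has \<open>\<up>F\<close> open.\<close>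

section \<open>Upper sets in the specialization order\<close>

lemma spec_up_iff: "y \<in> spec_up X F \<longleftrightarrow> y \<in> topspace X \<and> (\<exists>x\<in>F. x \<in> X closure_of {y})"
  by (auto simp: up_set_def specialization_def)

lemma spec_up_mono: "F \<subseteq> G \<Longrightarrow> spec_up X F \<subseteq> spec_up X G"
  unfolding subset_iff spec_up_iff by blast

lemma subset_spec_up: "F \<subseteq> topspace X \<Longrightarrow> F \<subseteq> spec_up X F"
  by (fastforce simp: spec_up_iff in_closure_of)

lemma closure_of_singleton_subset: "closedin X C \<Longrightarrow> x \<in> C \<Longrightarrow> X closure_of {x} \<subseteq> C"
  by (intro closure_of_minimal) auto

lemma closure_of_singleton_trans:
  "x \<in> X closure_of {y} \<Longrightarrow> y \<in> X closure_of {z} \<Longrightarrow> x \<in> X closure_of {z}"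
  using closure_of_singleton_subset[OF closedin_closure_of] by fastforce

lemma spec_up_idem: "spec_up X (spec_up X F) \<subseteq> spec_up X F"
  unfolding subset_iff spec_up_iff by (meson closure_of_singleton_trans spec_up_iff)

lemma spec_up_openin: "openin X U \<Longrightarrow> spec_up X U \<subseteq> U"
  by (auto simp: spec_up_iff in_closure_of)

lemma spec_up_subset_openin: "openin X U \<Longrightarrow> F \<subseteq> U \<Longrightarrow> spec_up X F \<subseteq> U"
  using spec_up_mono spec_up_openin by (metis subset_trans)

text \<open>Closed sets are lower sets in the specialization order, so a point of \<open>C\<close>
  above some \<open>x\<close> in \<open>F\<close> pulls \<open>x\<close> into
  \<open>C\<close>.\<close>

lemma meets_closed_iff:
  assumes "closedin X C"
  shows "spec_up X F \<inter> C \<noteq> {} \<longleftrightarrow> F \<inter> C \<noteq> {}"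
proof
  assume "spec_up X F \<inter> C \<noteq> {}"
  then obtain y x where "y \<in> C" "x \<in> F" "x \<in> X closure_of {y}"
    by (auto simp: spec_up_iff)
  with closure_of_singleton_subset[OF assms] show "F \<inter> C \<noteq> {}" by blast
next
  assume "F \<inter> C \<noteq> {}"
  then show "spec_up X F \<inter> C \<noteq> {}"
    using closedin_subset[OF assms] by (force simp: spec_up_iff in_closure_of)
qed

lemma open_meets_closure_singleton:
  "openin X U \<Longrightarrow> U \<inter> X closure_of {x} \<noteq> {} \<longleftrightarrow> x \<in> U"
  using openin_Int_closure_of_eq_empty[of X U "{x}"] by auto

text \<open>A member \<open>T\<close> minimal under inclusion works: the member inside its interior
  is contained in \<open>T\<close>, hence equal to \<open>T\<close>, so \<open>T\<close> is its own
  interior.\<close>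

lemma ex_open_minimal_upper:
  assumes "finite \<T>" "\<T> \<noteq> {}" "\<And>T. T \<in> \<T> \<Longrightarrow> \<exists>T'\<in>\<T>. T' \<subseteq> X interior_of T"
  shows "\<exists>T\<in>\<T>. X interior_of T = T"
proof -
  obtain T where T: "T \<in> \<T>" "\<And>T'. T' \<in> \<T> \<Longrightarrow> T' \<subseteq> T \<Longrightarrow> T = T'"
    using finite_has_minimal[OF assms(1,2)] by metis
  then show ?thesis
    using assms(3)[OF T(1)] interior_of_subset[of X T] by (metis subset_antisym subset_trans)
qed


section \<open>The lattice of closed sets\<close>

lemma carrier_closed_sets [simp]: "A \<in> carrier (closed_sets_lattice X) \<longleftrightarrow> closedin X A"
  by (simp add: closed_sets_lattice_def)

lemma le_closed_sets [simp]: "le (closed_sets_lattice X) = (\<subseteq>)"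
  by (simp add: closed_sets_lattice_def)

lemma up_set_closed_sets_iff:
  "B \<in> up_set (closed_sets_lattice X) G \<longleftrightarrow> closedin X B \<and> (\<exists>A\<in>G. A \<subseteq> B)"
  by (simp add: up_set_def)

lemma up_set_singleton_subset:
  "A \<in> up_set (closed_sets_lattice X) G \<Longrightarrow>
     up_set (closed_sets_lattice X) {A} \<subseteq> up_set (closed_sets_lattice X) G"
  unfolding subset_iff[of "up_set _ _"] up_set_closed_sets_iff by blast

lemma Union_closed_subset_topspace: "\<forall>A\<in>\<A>. closedin X A \<Longrightarrow> \<Union>\<A> \<subseteq> topspace X"
  by (meson Sup_least closedin_subset)

lemma sup_closed_sets:
  assumes "\<forall>A\<in>\<A>. closedin X A"
  shows "\<Squnion>\<^bsub>closed_sets_lattice X\<^esub>\<A> = X closure_of \<Union>\<A>"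
proof -
  let ?L = "closed_sets_lattice X"
  interpret complete_lattice ?L by (rule complete_lattice_closed_sets)
  have \<A>: "\<A> \<subseteq> carrier ?L" using assms by auto
  have "\<Squnion>\<^bsub>?L\<^esub>\<A> \<subseteq> X closure_of \<Union>\<A>"
    using sup_least[of \<A> "X closure_of \<Union>\<A>"] \<A> assms
      closure_of_subset[OF Union_closed_subset_topspace[OF assms]]
    by auto
  moreover have "X closure_of \<Union>\<A> \<subseteq> \<Squnion>\<^bsub>?L\<^esub>\<A>"
    using sup_upper[of \<A>] sup_closed[OF \<A>] \<A> by (intro closure_of_minimal) auto
  ultimately show ?thesis by blast
qed

text \<open>The conjunct \<open>x \<in> topspace X\<close> accounts for empty \<open>\<B>\<close>,
  whose infimum is the whole space. For the converse direction the closure of \<open>{x}\<close> is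
  a lower bound of \<open>\<B>\<close>.\<close>

lemma inf_closed_sets_iff:
  assumes "\<forall>B\<in>\<B>. closedin X B"
  shows "x \<in> \<Sqinter>\<^bsub>closed_sets_lattice X\<^esub>\<B> \<longleftrightarrow> x \<in> topspace X \<and> (\<forall>B\<in>\<B>. x \<in> B)"
proof -
  let ?L = "closed_sets_lattice X"
  interpret complete_lattice ?L by (rule complete_lattice_closed_sets)
  have \<B>: "\<B> \<subseteq> carrier ?L" using assms by auto
  show ?thesis
  proof
    assume "x \<in> \<Sqinter>\<^bsub>?L\<^esub>\<B>"
    moreover have "closedin X (\<Sqinter>\<^bsub>?L\<^esub>\<B>)"
      using inf_closed[OF \<B>] by simp
    moreover have "\<Sqinter>\<^bsub>?L\<^esub>\<B> \<subseteq> B" if "B \<in> \<B>" for B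
      using inf_lower[OF \<B> that] by simp
    ultimately show "x \<in> topspace X \<and> (\<forall>B\<in>\<B>. x \<in> B)"
      using closedin_subset by blast
  next
    assume x: "x \<in> topspace X \<and> (\<forall>B\<in>\<B>. x \<in> B)"
    then have "X closure_of {x} \<subseteq> \<Sqinter>\<^bsub>?L\<^esub>\<B>"
      using inf_greatest[of \<B> "X closure_of {x}"] \<B> assms closure_of_singleton_subset[of X _ x]
      by auto
    with x show "x \<in> \<Sqinter>\<^bsub>?L\<^esub>\<B>" by (auto simp: in_closure_of)
  qed
qed

lemma closedin_inf_closed_sets:
  assumes "\<forall>B\<in>\<B>. closedin X B"
  shows "closedin X (\<Sqinter>\<^bsub>closed_sets_lattice X\<^esub>\<B>)"
proof -
  interpret complete_lattice "closed_sets_lattice X" by (rule complete_lattice_closed_sets)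
  have "\<B> \<subseteq> carrier (closed_sets_lattice X)" using assms by auto
  from inf_closed[OF this] show ?thesis by simp
qed

text \<open>Suprema are closures of unions and the members of \<open>D\<close> are closed, so both
  memberships in upper sets reduce to inclusions.\<close>

lemma set_way_below_closed_sets:
  "set_way_below (closed_sets_lattice X) G H \<longleftrightarrow>
     (\<forall>D. (\<forall>d\<in>D. closedin X d) \<and> directed_wrt (\<subseteq>) D \<and> (\<exists>h\<in>H. h \<subseteq> X closure_of \<Union>D) \<longrightarrow>
        (\<exists>d\<in>D. \<exists>g\<in>G. g \<subseteq> d))"
  unfolding set_way_below_def le_closed_sets
proof (intro iff_allI)
  fix D :: "'a set set"
  let ?L = "closed_sets_lattice X"
  have "D \<subseteq> carrier ?L \<longleftrightarrow> (\<forall>d\<in>D. closedin X d)"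
    unfolding subset_iff carrier_closed_sets by blast
  moreover have "\<Squnion>\<^bsub>?L\<^esub>D \<in> up_set ?L H \<longleftrightarrow> (\<exists>h\<in>H. h \<subseteq> X closure_of \<Union>D)"
    if "\<forall>d\<in>D. closedin X d"
    using that by (simp add: sup_closed_sets up_set_closed_sets_iff)
  moreover have "D \<inter> up_set ?L G \<noteq> {} \<longleftrightarrow> (\<exists>d\<in>D. \<exists>g\<in>G. g \<subseteq> d)"
    if "\<forall>d\<in>D. closedin X d"
    using that unfolding disjoint_iff up_set_closed_sets_iff by blast
  ultimately show "(D \<subseteq> carrier ?L \<and> directed_wrt (\<subseteq>) D \<and> \<Squnion>\<^bsub>?L\<^esub>D \<in> up_set ?L H \<longrightarrow>
        D \<inter> up_set ?L G \<noteq> {}) \<longleftrightarrow>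
      ((\<forall>d\<in>D. closedin X d) \<and> directed_wrt (\<subseteq>) D \<and> (\<exists>h\<in>H. h \<subseteq> X closure_of \<Union>D) \<longrightarrow>
        (\<exists>d\<in>D. \<exists>g\<in>G. g \<subseteq> d))"
    by argo
qed

lemma set_way_below_mono_right:
  assumes "set_way_below L G H" "up_set L H' \<subseteq> up_set L H"
  shows "set_way_below L G H'"
  using assms unfolding set_way_below_def by blast

section \<open>Joins of families in the Smyth preorder\<close>

text \<open>On families of closed sets this is the binary join for the Smyth preorder: it generates
  the intersection of the two upper sets.\<close>

definition pairwise_Un :: "'a set set \<Rightarrow> 'a set set \<Rightarrow> 'a set set" where
  "pairwise_Un G H = (\<lambda>(A, B). A \<union> B) ` (G \<times> H)"

lemma pairwise_Un_singletons [simp]: "pairwise_Un {A} {B} = {A \<union> B}"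
  by (simp add: pairwise_Un_def)

lemma finite_pairwise_Un: "finite G \<Longrightarrow> finite H \<Longrightarrow> finite (pairwise_Un G H)"
  by (simp add: pairwise_Un_def)

lemma pairwise_Un_carrier:
  assumes "G \<subseteq> carrier (closed_sets_lattice X)" "H \<subseteq> carrier (closed_sets_lattice X)"
  shows "pairwise_Un G H \<subseteq> carrier (closed_sets_lattice X)"
  using assms by (fastforce simp: pairwise_Un_def)

lemma up_set_pairwise_Un:
  "up_set (closed_sets_lattice X) (pairwise_Un G H) =
     up_set (closed_sets_lattice X) G \<inter> up_set (closed_sets_lattice X) H"
  by (force simp: pairwise_Un_def up_set_closed_sets_iff)

text \<open>Both families have a member below some element of \<open>D\<close>; directedness of
  \<open>D\<close> puts the two members, hence their union, below a common element.\<close>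

lemma set_way_below_pairwise_Un:
  assumes "set_way_below (closed_sets_lattice X) G1 H" "set_way_below (closed_sets_lattice X) G2 H"
  shows "set_way_below (closed_sets_lattice X) (pairwise_Un G1 G2) H"
  unfolding set_way_below_closed_sets
proof (intro allI impI)
  fix D
  assume D: "(\<forall>d\<in>D. closedin X d) \<and> directed_wrt (\<subseteq>) D \<and> (\<exists>h\<in>H. h \<subseteq> X closure_of \<Union>D)"
  obtain d1 g1 where 1: "d1 \<in> D" "g1 \<in> G1" "g1 \<subseteq> d1"
    using assms(1) D unfolding set_way_below_closed_sets by blast
  obtain d2 g2 where 2: "d2 \<in> D" "g2 \<in> G2" "g2 \<subseteq> d2"
    using assms(2) D unfolding set_way_below_closed_sets by blast
  obtain d where "d \<in> D" "d1 \<subseteq> d" "d2 \<subseteq> d"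
    using D 1 2 unfolding directed_wrt_def by blast
  with 1 2 show "\<exists>d\<in>D. \<exists>g\<in>pairwise_Un G1 G2. g \<subseteq> d"
    unfolding pairwise_Un_def by (intro bexI[of _ d] bexI[of _ "g1 \<union> g2"]) auto
qed

lemma directed_wrt_subsetI:
  "{} \<in> \<A> \<Longrightarrow> (\<And>A B. A \<in> \<A> \<Longrightarrow> B \<in> \<A> \<Longrightarrow> A \<union> B \<in> \<A>) \<Longrightarrow> directed_wrt (\<subseteq>) \<A>"
  unfolding directed_wrt_def by (metis empty_iff sup_ge1 sup_ge2)

lemma directed_wrt_smythI:
  assumes "\<G> \<noteq> {}" "\<And>G H. G \<in> \<G> \<Longrightarrow> H \<in> \<G> \<Longrightarrow> pairwise_Un G H \<in> \<G>"
  shows "directed_wrt (smyth_le (closed_sets_lattice X)) \<G>"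
  unfolding directed_wrt_def
proof (intro conjI ballI assms(1))
  fix G H assume "G \<in> \<G>" "H \<in> \<G>"
  then show "\<exists>Z\<in>\<G>. smyth_le (closed_sets_lattice X) G Z \<and> smyth_le (closed_sets_lattice X) H Z"
    using assms(2) by (intro bexI[of _ "pairwise_Un G H"]) (auto simp: smyth_le_def up_set_pairwise_Un)
qed

text \<open>A directed \<open>D\<close> is nonempty and the empty set lies below each of its
  members. This makes all the approximating families below nonempty.\<close>

lemma empty_set_way_below: "set_way_below (closed_sets_lattice X) {{}} H"
  by (auto simp: set_way_below_closed_sets directed_wrt_def)

text \<open>The directed family \<open>{B}\<close> has supremum \<open>B\<close>, since
  \<open>B\<close> is closed.\<close>

lemma way_below_imp_subset:
  assumes "closedin X B" "way_below (closed_sets_lattice X) A B"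
  shows "A \<subseteq> B"
  using assms unfolding way_below_def set_way_below_closed_sets
  by (auto simp: directed_wrt_def closure_of_closedin dest!: spec[of _ "{B}"])


section \<open>Way-below and interiors of upper sets\<close>

text \<open>The lower sets generated by the finite subsets of \<open>S\<close>. Admitting
  \<open>E = {}\<close> keeps the family nonempty, hence directed, even when \<open>S\<close> is
  empty.\<close>

definition finite_down_sets :: "'a topology \<Rightarrow> 'a set \<Rightarrow> 'a set set" where
  "finite_down_sets X S = {\<Union>z\<in>E. X closure_of {z} | E. finite E \<and> E \<subseteq> S}"

lemma closedin_finite_down_sets: "d \<in> finite_down_sets X S \<Longrightarrow> closedin X d"
  by (auto simp: finite_down_sets_def intro!: closedin_Union)

lemma directed_finite_down_sets: "directed_wrt (\<subseteq>) (finite_down_sets X S)"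
  unfolding directed_wrt_def
proof (intro conjI ballI)
  show "finite_down_sets X S \<noteq> {}" by (auto simp: finite_down_sets_def)
next
  fix x y assume "x \<in> finite_down_sets X S" "y \<in> finite_down_sets X S"
  then obtain E F where "finite E" "E \<subseteq> S" "x = (\<Union>z\<in>E. X closure_of {z})"
      "finite F" "F \<subseteq> S" "y = (\<Union>z\<in>F. X closure_of {z})"
    by (auto simp: finite_down_sets_def)
  then show "\<exists>d\<in>finite_down_sets X S. x \<subseteq> d \<and> y \<subseteq> d"
    unfolding finite_down_sets_def
    by (intro bexI[of _ "\<Union>z\<in>E \<union> F. X closure_of {z}"] CollectI exI[of _ "E \<union> F"]) auto
qed

lemma subset_Union_finite_down_sets:
  assumes "S \<subseteq> topspace X"
  shows "S \<subseteq> \<Union>(finite_down_sets X S)"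
proof
  fix z assume "z \<in> S"
  then have "X closure_of {z} \<in> finite_down_sets X S"
    unfolding finite_down_sets_def by (intro CollectI exI[of _ "{z}"]) auto
  then show "z \<in> \<Union>(finite_down_sets X S)"
    using \<open>z \<in> S\<close> assms by (intro UnionI[of "X closure_of {z}"]) (auto simp: in_closure_of)
qed

text \<open>The sets in \<open>finite_down_sets X S\<close> form a directed family whose supremum
  contains \<open>S\<close>, hence also \<open>H\<close>; the way-below relation then puts a member
  of \<open>\<F>\<close> inside one of them.\<close>

lemma set_way_below_finite_generators:
  assumes "set_way_below (closed_sets_lattice X) \<F> \<H>" "H \<in> \<H>" "H \<subseteq> X closure_of S" "S \<subseteq> topspace X"
  obtains E K where "finite E" "E \<subseteq> S" "K \<in> \<F>" "K \<subseteq> (\<Union>z\<in>E. X closure_of {z})"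
proof -
  have "H \<subseteq> X closure_of \<Union>(finite_down_sets X S)"
    using assms(3) closure_of_mono[OF subset_Union_finite_down_sets[OF assms(4)]] by blast
  then obtain d K where "d \<in> finite_down_sets X S" "K \<in> \<F>" "K \<subseteq> d"
    using assms(1,2) closedin_finite_down_sets[of _ X S] directed_finite_down_sets[of X S]
    unfolding set_way_below_closed_sets by blast
  then show thesis
    using that by (auto simp: finite_down_sets_def)
qed

lemma set_way_below_interior_meets:
  assumes wb: "set_way_below (closed_sets_lattice X) \<F> \<H>"
    and T: "spec_up X T \<subseteq> T"
    and meets: "\<And>K. K \<in> \<F> \<Longrightarrow> T \<inter> K \<noteq> {}"
    and H: "H \<in> \<H>" "closedin X H"
  shows "X interior_of T \<inter> H \<noteq> {}"
proof
  assume "X interior_of T \<inter> H = {}"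
  then have "H \<subseteq> X closure_of (topspace X - T)"
    using closedin_subset[OF H(2)] by (auto simp: closure_of_complement)
  then obtain E K where E: "E \<subseteq> topspace X - T" "K \<in> \<F>" "K \<subseteq> (\<Union>z\<in>E. X closure_of {z})"
    using set_way_below_finite_generators[OF wb H(1)] by (metis Diff_subset)
  \<comment> \<open>The point \<open>t\<close> of \<open>T\<close> lies below a generator
    \<open>z\<close> outside \<open>T\<close>, which contradicts that \<open>T\<close> is an upper
    set.\<close>
  then obtain t z where "t \<in> T" "z \<in> E" "t \<in> X closure_of {z}"
    using meets by blast
  with E T show False
    by (auto simp: subset_iff spec_up_iff)
qed

text \<open>An open set meeting the closure of \<open>\<Union>D\<close> already meets some
  \<open>d\<close> in \<open>D\<close>. A common point is above some \<open>x\<close> in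
  \<open>F\<close>, and the closed set \<open>d\<close> then contains the closure of
  \<open>{x}\<close>.\<close>

lemma set_way_below_point_closures:
  assumes "\<And>H. H \<in> \<H> \<Longrightarrow> X interior_of (spec_up X F) \<inter> H \<noteq> {}"
  shows "set_way_below (closed_sets_lattice X) ((\<lambda>x. X closure_of {x}) ` F) \<H>"
  unfolding set_way_below_closed_sets
proof (intro allI impI)
  fix D
  assume D: "(\<forall>d\<in>D. closedin X d) \<and> directed_wrt (\<subseteq>) D \<and> (\<exists>h\<in>\<H>. h \<subseteq> X closure_of \<Union>D)"
  then have "X interior_of (spec_up X F) \<inter> X closure_of \<Union>D \<noteq> {}"
    using assms by blast
  then have "X interior_of (spec_up X F) \<inter> \<Union>D \<noteq> {}"
    by (simp add: openin_Int_closure_of_eq_empty)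
  then obtain d z where d: "d \<in> D" "z \<in> d" "z \<in> spec_up X F"
    using interior_of_subset by fastforce
  with D have "X closure_of {z} \<subseteq> d"
    by (intro closure_of_singleton_subset) auto
  moreover obtain x where "x \<in> F" "x \<in> X closure_of {z}"
    using d(3) by (auto simp: spec_up_iff)
  ultimately show "\<exists>d\<in>D. \<exists>g\<in>(\<lambda>x. X closure_of {x}) ` F. g \<subseteq> d"
    using d(1) D closure_of_singleton_subset[of X d x] by blast
qed

lemma way_below_point_closure:
  assumes "x \<in> X interior_of (spec_up X {y})" "x \<in> A"
  shows "way_below (closed_sets_lattice X) (X closure_of {y}) A"
  using set_way_below_point_closures[of "{A}" X "{y}"] assms by (auto simp: way_below_def)

lemma interior_of_spec_up_transversal:
  assumes "set_way_below (closed_sets_lattice X) \<F> {X closure_of {x}}"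
    and "\<And>K. K \<in> \<F> \<Longrightarrow> closedin X K \<and> F \<inter> K \<noteq> {}"
  shows "x \<in> X interior_of (spec_up X F)"
  using set_way_below_interior_meets[OF assms(1) spec_up_idem, of F "X closure_of {x}"]
    meets_closed_iff[of X _ F] assms(2) open_meets_closure_singleton[of X "X interior_of spec_up X F" x]
  by auto


section \<open>Continuity\<close>

text \<open>The sets way below \<open>A\<close> include the empty set and are closed under binary
  union, hence directed. Their union is dense in \<open>A\<close>: near \<open>x\<close> in
  \<open>A\<close> there is \<open>y\<close> with \<open>x\<close> in the interior of its upper set,
  so the closure of \<open>{y}\<close> is way below \<open>A\<close>.\<close>

lemma continuous_space_imp_continuous_lattice:
  assumes "continuous_space X"
  shows "continuous_lattice (closed_sets_lattice X)"
  unfolding continuous_lattice_def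
proof (intro conjI ballI complete_lattice_closed_sets)
  let ?L = "closed_sets_lattice X"
  fix A assume "A \<in> carrier ?L"
  then have A: "closedin X A" by simp
  let ?W = "{B \<in> carrier ?L. way_below ?L B A}"
  have "B1 \<union> B2 \<in> ?W" if "B1 \<in> ?W" "B2 \<in> ?W" for B1 B2
    using that set_way_below_pairwise_Un[of X "{B1}" "{A}" "{B2}"] by (auto simp: way_below_def)
  moreover have "{} \<in> ?W"
    by (simp add: way_below_def empty_set_way_below)
  ultimately show "directed_wrt (le ?L) ?W"
    unfolding le_closed_sets by (intro directed_wrt_subsetI)
  have "A \<subseteq> X closure_of \<Union>?W"
  proof
    fix x assume x: "x \<in> A"
    show "x \<in> X closure_of \<Union>?W"
      unfolding in_closure_of
    proof (intro conjI allI impI)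
      show "x \<in> topspace X" using x closedin_subset[OF A] by auto
      fix U assume U: "x \<in> U \<and> openin X U"
      then obtain y where y: "y \<in> U" "x \<in> X interior_of (spec_up X {y})"
        using assms unfolding continuous_space_def by blast
      have "X closure_of {y} \<in> ?W"
        using way_below_point_closure[OF y(2) x] by simp
      moreover have "y \<in> X closure_of {y}"
        using y(1) U openin_subset[of X U] by (auto simp: in_closure_of)
      ultimately show "\<exists>y. y \<in> \<Union>?W \<and> y \<in> U"
        using y(1) by blast
    qed
  qed
  moreover have "X closure_of \<Union>?W \<subseteq> A"
    using way_below_imp_subset[OF A] A by (intro closure_of_minimal) auto
  ultimately show "A = \<Squnion>\<^bsub>?L\<^esub>?W"
    by (simp add: sup_closed_sets)
qed

text \<open>The open set \<open>U\<close> meets the supremum of the sets way below the closure of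
  \<open>{y}\<close>, hence meets one such \<open>B\<close>; any point of
  \<open>B \<inter> U\<close> is a transversal of \<open>{B}\<close>.\<close>

lemma continuous_lattice_imp_continuous_space:
  assumes "continuous_lattice (closed_sets_lattice X)"
  shows "continuous_space X"
  unfolding continuous_space_def
proof (intro allI impI)
  let ?L = "closed_sets_lattice X"
  fix U y assume U: "openin X U \<and> y \<in> U"
  let ?W = "{B \<in> carrier ?L. way_below ?L B (X closure_of {y})}"
  have "X closure_of {y} = \<Squnion>\<^bsub>?L\<^esub>?W"
    using assms by (simp add: continuous_lattice_def)
  also have "\<dots> = X closure_of \<Union>?W"
    by (rule sup_closed_sets) simp
  finally have eq: "X closure_of \<Union>?W = X closure_of {y}" by (rule sym)
  have "U \<inter> X closure_of \<Union>?W \<noteq> {}"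
    unfolding eq using U by (simp add: open_meets_closure_singleton)
  then have "U \<inter> \<Union>?W \<noteq> {}"
    by (simp only: openin_Int_closure_of_eq_empty[OF conjunct1[OF U]] not_False_eq_True)
  then obtain B x where "closedin X B" "way_below ?L B (X closure_of {y})" "x \<in> B" "x \<in> U"
    by auto
  then show "\<exists>x\<in>U. y \<in> X interior_of (spec_up X {x})"
    using interior_of_spec_up_transversal[of X "{B}" y "{x}"] by (auto simp: way_below_def)
qed

section \<open>Complete distributivity\<close>

lemma continuous_space_imp_completely_distributive:
  assumes "continuous_space X"
  shows "completely_distributive (closed_sets_lattice X)"
  unfolding completely_distributive_def
proof (intro conjI allI impI complete_lattice_closed_sets)
  let ?L = "closed_sets_lattice X"
  fix \<A> assume "\<A> \<subseteq> Pow (carrier ?L)"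
  then have \<A>: "\<And>A B. A \<in> \<A> \<Longrightarrow> B \<in> A \<Longrightarrow> closedin X B"
    using carrier_closed_sets by blast
  define \<C> where "\<C> = {f ` \<A> | f. \<forall>A\<in>\<A>. f A \<in> A}"
  let ?l = "\<Sqinter>\<^bsub>?L\<^esub>((\<lambda>A. \<Squnion>\<^bsub>?L\<^esub>A) ` \<A>)" and ?r = "\<Squnion>\<^bsub>?L\<^esub>((\<lambda>B. \<Sqinter>\<^bsub>?L\<^esub>B) ` \<C>)"
  have \<C>: "\<And>C B. C \<in> \<C> \<Longrightarrow> B \<in> C \<Longrightarrow> closedin X B"
    using \<A> unfolding \<C>_def by auto
  have sups: "\<Squnion>\<^bsub>?L\<^esub>A = X closure_of \<Union>A" if "A \<in> \<A>" for A
    using that \<A> by (intro sup_closed_sets) auto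
  have infs: "closedin X (\<Sqinter>\<^bsub>?L\<^esub>C)" if "C \<in> \<C>" for C
    using \<C>[OF that] by (intro closedin_inf_closed_sets) blast
  have l: "x \<in> ?l \<longleftrightarrow> x \<in> topspace X \<and> (\<forall>A\<in>\<A>. x \<in> X closure_of \<Union>A)" for x
    using sups by (subst inf_closed_sets_iff) auto
  have r: "?r = X closure_of (\<Union>C\<in>\<C>. \<Sqinter>\<^bsub>?L\<^esub>C)"
    using infs by (subst sup_closed_sets) auto
  \<comment> \<open>This inequality holds in every complete lattice.\<close>
  have "?r \<subseteq> ?l"
    unfolding r
  proof (rule closure_of_minimal)
    show "(\<Union>C\<in>\<C>. \<Sqinter>\<^bsub>?L\<^esub>C) \<subseteq> ?l"
    proof clarify
      fix C x assume C: "C \<in> \<C>" and x: "x \<in> \<Sqinter>\<^bsub>?L\<^esub>C"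
      obtain f where f: "C = f ` \<A>" "\<forall>A\<in>\<A>. f A \<in> A"
        using C unfolding \<C>_def by blast
      have x': "x \<in> topspace X" "\<forall>B\<in>C. x \<in> B"
        using x inf_closed_sets_iff[of C X x] \<C>[OF C] by auto
      have "x \<in> X closure_of \<Union>A" if "A \<in> \<A>" for A
      proof -
        have "\<Union>A \<subseteq> X closure_of \<Union>A"
          using \<A>[OF that] by (intro closure_of_subset Union_closed_subset_topspace) blast
        moreover have "f A \<in> A" "x \<in> f A"
          using that f x'(2) by auto
        ultimately show ?thesis by blast
      qed
      with x'(1) show "x \<in> ?l" by (simp add: l)
    qed
    show "closedin X ?l"
      using sups by (intro closedin_inf_closed_sets) auto
  qed
  moreover have "?l \<subseteq> ?r"
  proof
    fix y assume "y \<in> ?l"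
    then have y: "y \<in> topspace X" "\<And>A. A \<in> \<A> \<Longrightarrow> y \<in> X closure_of \<Union>A"
      by (simp_all add: l)
    show "y \<in> ?r"
      unfolding r in_closure_of
    proof (intro conjI allI impI y(1))
      fix U assume U: "y \<in> U \<and> openin X U"
      then obtain x where x: "x \<in> U" "y \<in> X interior_of (spec_up X {x})"
        using assms unfolding continuous_space_def by blast
      \<comment> \<open>The interior of the upper set of \<open>x\<close> is a neighbourhood of
        \<open>y\<close>, so it meets some \<open>B\<close> in \<open>A\<close>; being a lower set,
        \<open>B\<close> contains \<open>x\<close>. Selecting such a \<open>B\<close> for every
        \<open>A\<close> gives the choice function.\<close>
      have "\<exists>B\<in>A. x \<in> B" if "A \<in> \<A>" for A
      proof -
        have "y \<in> X closure_of \<Union>A" using y(2) that .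
        then obtain z where "z \<in> \<Union>A" "z \<in> X interior_of (spec_up X {x})"
          using x(2) unfolding in_closure_of by (meson openin_interior_of)
        then obtain B where "B \<in> A" "z \<in> B" "x \<in> X closure_of {z}"
          using interior_of_subset[of X "spec_up X {x}"] by (auto simp: subset_iff spec_up_iff)
        moreover have "closedin X B" using \<A> that \<open>B \<in> A\<close> .
        ultimately show ?thesis
          using closure_of_singleton_subset[of X B z] by blast
      qed
      then obtain f where f: "\<And>A. A \<in> \<A> \<Longrightarrow> f A \<in> A \<and> x \<in> f A" by metis
      then have "f ` \<A> \<in> \<C>" unfolding \<C>_def by blast
      moreover have "x \<in> \<Sqinter>\<^bsub>?L\<^esub>(f ` \<A>)"
        using f \<C>[OF \<open>f ` \<A> \<in> \<C>\<close>] openin_subset[of X U] U x(1)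
        by (subst inf_closed_sets_iff) auto
      ultimately show "\<exists>y. y \<in> (\<Union>C\<in>\<C>. \<Sqinter>\<^bsub>?L\<^esub>C) \<and> y \<in> U"
        using x(1) by blast
    qed
  qed
  ultimately show "?l = \<Squnion>\<^bsub>?L\<^esub>((\<lambda>B. \<Sqinter>\<^bsub>?L\<^esub>B) ` {f ` \<A> | f. \<forall>A\<in>\<A>. f A \<in> A})"
    unfolding \<C>_def by blast
qed

text \<open>For given \<open>y\<close>, distributivity is applied to all families of closed sets whose supremum
  contains \<open>y\<close>.\<close>

lemma completely_distributive_imp_continuous_space:
  assumes "completely_distributive (closed_sets_lattice X)"
  shows "continuous_space X"
  unfolding continuous_space_def
proof (intro allI impI)
  let ?L = "closed_sets_lattice X"
  fix U y assume U: "openin X U \<and> y \<in> U"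
  then have y: "y \<in> topspace X" using openin_subset by blast
  define \<A> where "\<A> = {A. A \<subseteq> carrier ?L \<and> y \<in> X closure_of \<Union>A}"
  define \<C> where "\<C> = {f ` \<A> | f. \<forall>A\<in>\<A>. f A \<in> A}"
  have sups: "\<Squnion>\<^bsub>?L\<^esub>A = X closure_of \<Union>A" if "A \<in> \<A>" for A
    using that by (intro sup_closed_sets) (auto simp: \<A>_def)
  have \<C>: "\<And>C B. C \<in> \<C> \<Longrightarrow> B \<in> C \<Longrightarrow> closedin X B"
    unfolding \<C>_def \<A>_def subset_iff carrier_closed_sets by blast
  have infs: "closedin X (\<Sqinter>\<^bsub>?L\<^esub>C)" if "C \<in> \<C>" for C
    using \<C>[OF that] by (intro closedin_inf_closed_sets) blast
  have "\<A> \<subseteq> Pow (carrier ?L)" unfolding \<A>_def by blast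
  then have "\<Sqinter>\<^bsub>?L\<^esub>((\<lambda>A. \<Squnion>\<^bsub>?L\<^esub>A) ` \<A>) = \<Squnion>\<^bsub>?L\<^esub>((\<lambda>B. \<Sqinter>\<^bsub>?L\<^esub>B) ` \<C>)"
    using assms unfolding completely_distributive_def \<C>_def by blast
  also have "\<dots> = X closure_of (\<Union>C\<in>\<C>. \<Sqinter>\<^bsub>?L\<^esub>C)"
    using infs by (subst sup_closed_sets) auto
  moreover have "y \<in> \<Sqinter>\<^bsub>?L\<^esub>((\<lambda>A. \<Squnion>\<^bsub>?L\<^esub>A) ` \<A>)"
    using y sups by (subst inf_closed_sets_iff) (auto simp: \<A>_def)
  ultimately have "y \<in> X closure_of (\<Union>C\<in>\<C>. \<Sqinter>\<^bsub>?L\<^esub>C)" by simp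
  then obtain C x where C: "C \<in> \<C>" and x: "x \<in> \<Sqinter>\<^bsub>?L\<^esub>C" "x \<in> U"
    using U unfolding in_closure_of by blast
  obtain f where f: "C = f ` \<A>" "\<And>A. A \<in> \<A> \<Longrightarrow> f A \<in> A"
    using C unfolding \<C>_def by blast
  have xf: "x \<in> f A" if "A \<in> \<A>" for A
    using x(1) inf_closed_sets_iff[of C X x] \<C>[OF C] f(1) that by auto
  have "y \<in> X interior_of (spec_up X {x})"
  proof (rule ccontr)
    assume "y \<notin> X interior_of (spec_up X {x})"
    \<comment> \<open>If \<open>y\<close> is not in the interior, it is in the closure of the points
      not above \<open>x\<close>. Their point closures form a family \<open>A\<close> in
      \<open>\<A>\<close>, so \<open>x\<close> lies in \<open>f A\<close>, the closure of a point
      not above \<open>x\<close>.\<close>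
    define S where "S = topspace X - spec_up X {x}"
    define A where "A = (\<lambda>z. X closure_of {z}) ` S"
    have "S \<subseteq> \<Union>A"
      by (auto simp: S_def A_def in_closure_of)
    moreover have "y \<in> X closure_of S"
      using \<open>y \<notin> _\<close> y by (simp add: S_def closure_of_complement)
    ultimately have "y \<in> X closure_of \<Union>A"
      using closure_of_mono by blast
    then have "A \<in> \<A>" by (auto simp: \<A>_def A_def)
    then have "f A \<in> A" "x \<in> f A" using f xf by auto
    then show False by (auto simp: A_def S_def spec_up_iff)
  qed
  with x(2) show "\<exists>x\<in>U. y \<in> X interior_of (spec_up X {x})" by blast
qed


section \<open>Quasicontinuity\<close>

text \<open>If \<open>B\<close> is not above \<open>A\<close>, a point of \<open>A\<close> outside
  \<open>B\<close> has a neighbourhood of the form \<open>spec_up X F\<close> disjoint from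
  \<open>B\<close>, with \<open>F\<close> finite. The point closures of \<open>F\<close> are way
  below \<open>A\<close>, and none of them lies inside \<open>B\<close>.\<close>

lemma quasicontinuous_space_imp_quasicontinuous_lattice:
  assumes "quasicontinuous_space X"
  shows "quasicontinuous_lattice (closed_sets_lattice X)"
  unfolding quasicontinuous_lattice_def
proof (intro conjI ballI complete_lattice_closed_sets)
  let ?L = "closed_sets_lattice X"
  fix A assume "A \<in> carrier ?L"
  then have A: "closedin X A" by simp
  let ?W = "fin_way_below ?L A"
  have "pairwise_Un G H \<in> ?W" if "G \<in> ?W" "H \<in> ?W" for G H
    using that by (simp add: fin_way_below_def finite_pairwise_Un pairwise_Un_carrier
        set_way_below_pairwise_Un)
  moreover have "{{}} \<in> ?W"
    by (simp add: fin_way_below_def empty_set_way_below)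
  ultimately show "directed_wrt (smyth_le ?L) ?W"
    by (intro directed_wrt_smythI) blast+
  have "B \<in> up_set ?L {A}" if B: "\<forall>\<F>\<in>?W. B \<in> up_set ?L \<F>" for B
  proof (rule ccontr)
    have cB: "closedin X B"
      using B \<open>{{}} \<in> ?W\<close> by (auto simp: up_set_closed_sets_iff)
    assume "B \<notin> up_set ?L {A}"
    then obtain x where x: "x \<in> A" "x \<in> topspace X - B"
      using cB closedin_subset[OF A] by (auto simp: up_set_closed_sets_iff)
    then obtain F where F: "finite F" "F \<subseteq> topspace X" "x \<in> X interior_of (spec_up X F)"
        "spec_up X F \<subseteq> topspace X - B"
      using assms cB unfolding quasicontinuous_space_def by (meson openin_diff openin_topspace)
    have "(\<lambda>x. X closure_of {x}) ` F \<in> ?W"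
      using F x(1) set_way_below_point_closures[of "{A}" X F] by (auto simp: fin_way_below_def)
    then have "B \<in> up_set ?L ((\<lambda>x. X closure_of {x}) ` F)"
      using B by (rule bspec[rotated])
    then obtain f where "f \<in> F" "X closure_of {f} \<subseteq> B"
      unfolding up_set_closed_sets_iff by blast
    then show False
      using F(2,4) subset_spec_up[OF F(2)] by (force simp: in_closure_of)
  qed
  moreover have "A \<in> up_set ?L \<F>" if "\<F> \<in> ?W" for \<F>
  proof -
    \<comment> \<open>The way-below relation is tested on the directed family
      \<open>{A}\<close>.\<close>
    have "\<exists>d\<in>{A}. \<exists>g\<in>\<F>. g \<subseteq> d"
      using that A unfolding fin_way_below_def set_way_below_closed_sets
      by (auto simp: directed_wrt_def closure_of_closedin dest!: spec[of _ "{A}"])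
    with A show ?thesis by (simp add: up_set_closed_sets_iff)
  qed
  then have "up_set ?L {A} \<subseteq> (\<Inter>\<F>\<in>?W. up_set ?L \<F>)"
    by (intro INT_greatest up_set_singleton_subset)
  ultimately show "up_set ?L {A} = (\<Inter>\<F>\<in>?W. up_set ?L \<F>)" by blast
qed

text \<open>The complement of \<open>U\<close> is not above the closure of \<open>{x}\<close>, so it
  is excluded by some finite \<open>\<F>\<close> way below that closure. Every member of
  \<open>\<F>\<close> then meets \<open>U\<close>, which gives a finite transversal inside
  \<open>U\<close>.\<close>

lemma quasicontinuous_lattice_imp_quasicontinuous_space:
  assumes "quasicontinuous_lattice (closed_sets_lattice X)"
  shows "quasicontinuous_space X"
  unfolding quasicontinuous_space_def
proof (intro allI impI)
  let ?L = "closed_sets_lattice X"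
  fix U x assume U: "openin X U \<and> x \<in> U"
  let ?W = "fin_way_below ?L (X closure_of {x})"
  have "up_set ?L {X closure_of {x}} = (\<Inter>\<F>\<in>?W. up_set ?L \<F>)"
    using assms by (simp add: quasicontinuous_lattice_def)
  moreover have "topspace X - U \<notin> up_set ?L {X closure_of {x}}"
    using U openin_subset[of X U] by (auto simp: up_set_closed_sets_iff in_closure_of subset_iff)
  ultimately obtain \<F> where \<F>: "finite \<F>" "\<And>K. K \<in> \<F> \<Longrightarrow> closedin X K"
      "set_way_below ?L \<F> {X closure_of {x}}" "topspace X - U \<notin> up_set ?L \<F>"
    unfolding fin_way_below_def subset_iff carrier_closed_sets by blast
  then have "\<exists>z. z \<in> K \<inter> U" if "K \<in> \<F>" for K
    using that U closedin_subset[of X K] by (auto simp: up_set_closed_sets_iff)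
  then obtain f where f: "\<And>K. K \<in> \<F> \<Longrightarrow> f K \<in> K \<inter> U" by metis
  have FU: "f ` \<F> \<subseteq> U" using f by auto
  have "x \<in> X interior_of (spec_up X (f ` \<F>))"
    using f \<F>(2) by (intro interior_of_spec_up_transversal[OF \<F>(3)]) blast
  moreover have "spec_up X (f ` \<F>) \<subseteq> U"
    using spec_up_subset_openin U FU by blast
  moreover have "f ` \<F> \<subseteq> topspace X"
    using FU U openin_subset by blast
  ultimately show "\<exists>F. finite F \<and> F \<subseteq> topspace X \<and> x \<in> X interior_of (spec_up X F) \<and> spec_up X F \<subseteq> U"
    using \<F>(1) by blast
qed


section \<open>Algebraicity\<close>

lemma algebraic_space_imp_algebraic_lattice:
  assumes "algebraic_space X"
  shows "algebraic_lattice (closed_sets_lattice X)"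
  unfolding algebraic_lattice_def
proof (intro conjI ballI complete_lattice_closed_sets)
  let ?L = "closed_sets_lattice X"
  fix A assume "A \<in> carrier ?L"
  then have A: "closedin X A" by simp
  let ?W = "{K \<in> carrier ?L. way_below ?L K K \<and> K \<sqsubseteq>\<^bsub>?L\<^esub> A}"
  have "K1 \<union> K2 \<in> ?W" if "K1 \<in> ?W" "K2 \<in> ?W" for K1 K2
  proof -
    \<comment> \<open>Each \<open>Ki\<close> is way below itself, and the union lies above
      it.\<close>
    have "set_way_below ?L {K1} {K1 \<union> K2}" "set_way_below ?L {K2} {K1 \<union> K2}"
      using that by (auto simp: way_below_def up_set_closed_sets_iff
          intro: set_way_below_mono_right[of _ _ "{K1}"] set_way_below_mono_right[of _ _ "{K2}"])
    from set_way_below_pairwise_Un[OF this] that show ?thesis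
      by (auto simp: way_below_def)
  qed
  moreover have "{} \<in> ?W"
    by (simp add: way_below_def empty_set_way_below)
  ultimately show "directed_wrt (le ?L) ?W"
    unfolding le_closed_sets by (intro directed_wrt_subsetI)
  have "A \<subseteq> X closure_of \<Union>?W"
  proof
    fix x assume x: "x \<in> A"
    show "x \<in> X closure_of \<Union>?W"
      unfolding in_closure_of
    proof (intro conjI allI impI)
      show "x \<in> topspace X" using x closedin_subset[OF A] by auto
      fix U assume U: "x \<in> U \<and> openin X U"
      then obtain y where y: "y \<in> U" "x \<in> spec_up X {y}"
          "X interior_of (spec_up X {y}) = spec_up X {y}"
        using assms unfolding algebraic_space_def by blast
      have yy: "y \<in> X closure_of {y}"
        using y(1) U openin_subset[of X U] by (auto simp: in_closure_of)
      have "y \<in> spec_up X {y}"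
        using y(1) U openin_subset[of X U] by (auto simp: spec_up_iff in_closure_of)
      \<comment> \<open>Since \<open>spec_up X {y}\<close> is open, \<open>y\<close> lies in its
        interior, so its closure is compact.\<close>
      then have "way_below ?L (X closure_of {y}) (X closure_of {y})"
        using way_below_point_closure[of y X y] yy y(3) by blast
      moreover have "y \<in> A"
        using y(2) closure_of_singleton_subset[OF A x] by (auto simp: spec_up_iff)
      ultimately have "X closure_of {y} \<in> ?W"
        using closure_of_singleton_subset[OF A] by simp
      then show "\<exists>y. y \<in> \<Union>?W \<and> y \<in> U"
        using y(1) yy by blast
    qed
  qed
  moreover have "X closure_of \<Union>?W \<subseteq> A"
    using A by (intro closure_of_minimal) auto
  ultimately show "A = \<Squnion>\<^bsub>?L\<^esub>?W"
    by (simp add: sup_closed_sets)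
qed

lemma algebraic_lattice_imp_algebraic_space:
  assumes "algebraic_lattice (closed_sets_lattice X)"
  shows "algebraic_space X"
  unfolding algebraic_space_def
proof (intro allI impI)
  let ?L = "closed_sets_lattice X"
  fix U x assume U: "openin X U \<and> x \<in> U"
  let ?W = "{K \<in> carrier ?L. way_below ?L K K \<and> K \<sqsubseteq>\<^bsub>?L\<^esub> X closure_of {x}}"
  have "X closure_of {x} = \<Squnion>\<^bsub>?L\<^esub>?W"
    by (rule assms[unfolded algebraic_lattice_def, THEN conjunct2, THEN bspec, THEN conjunct2]) simp
  also have "\<dots> = X closure_of \<Union>?W"
    by (rule sup_closed_sets) simp
  finally have eq: "X closure_of \<Union>?W = X closure_of {x}" by (rule sym)
  have "U \<inter> X closure_of \<Union>?W \<noteq> {}"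
    unfolding eq using U by (simp add: open_meets_closure_singleton)
  then have "U \<inter> \<Union>?W \<noteq> {}"
    by (simp only: openin_Int_closure_of_eq_empty[OF conjunct1[OF U]] not_False_eq_True)
  then obtain K where K: "closedin X K" "set_way_below ?L {K} {K}" "K \<subseteq> X closure_of {x}"
      "U \<inter> K \<noteq> {}"
    by (auto simp: way_below_def)
  \<comment> \<open>Compactness, applied to \<open>K\<close> as the closure of its own points, makes
    \<open>K\<close> the lower set of finitely many of them.\<close>
  obtain G where G: "finite G" "G \<subseteq> K" "K \<subseteq> (\<Union>z\<in>G. X closure_of {z})"
    using set_way_below_finite_generators[OF K(2), of K K] K(1) closure_of_subset closedin_subset
    by (metis singletonD singletonI)
  have open_meets_G: "\<exists>y\<in>G. y \<in> V" if V: "openin X V" "V \<inter> K \<noteq> {}" for V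
    using that G(3) open_meets_closure_singleton[OF V(1)] by blast
  define \<T> where "\<T> = (\<lambda>y. spec_up X {y}) ` (G \<inter> U)"
  have "\<exists>T\<in>\<T>. X interior_of T = T"
  proof (rule ex_open_minimal_upper)
    show "finite \<T>" using G(1) by (simp add: \<T>_def)
    show "\<T> \<noteq> {}" using open_meets_G[of U] U K(4) by (auto simp: \<T>_def)
    fix T assume "T \<in> \<T>"
    then obtain y where y: "T = spec_up X {y}" "y \<in> G" "y \<in> U" by (auto simp: \<T>_def)
    have "X interior_of T \<inter> K \<noteq> {}"
      using set_way_below_interior_meets[OF K(2), of T K] K(1) y G(2)
        spec_up_idem[of X "{y}"] meets_closed_iff[OF K(1), of "{y}"] by auto
    \<comment> \<open>The interior of \<open>T\<close> meets \<open>K\<close> and so contains a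
      generator, whose upper set stays inside that interior.\<close>
    then obtain y' where y': "y' \<in> G" "y' \<in> X interior_of T"
      using open_meets_G[OF openin_interior_of] by blast
    have "T \<subseteq> U" using spec_up_subset_openin[of X U "{y}"] U y by auto
    then have "y' \<in> U" using y'(2) interior_of_subset[of X T] by blast
    then show "\<exists>T'\<in>\<T>. T' \<subseteq> X interior_of T"
      using y' spec_up_subset_openin[OF openin_interior_of, of "{y'}"] by (auto simp: \<T>_def)
  qed
  then obtain y where y: "y \<in> G" "y \<in> U" "X interior_of (spec_up X {y}) = spec_up X {y}"
    by (auto simp: \<T>_def)
  moreover have "x \<in> spec_up X {y}"
    using y(1) G(2) K(3) U openin_subset[of X U] by (auto simp: spec_up_iff)
  ultimately show "\<exists>y\<in>U. x \<in> X interior_of (spec_up X {y}) \<and>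
      X interior_of (spec_up X {y}) = spec_up X {y}"
    by blast
qed


section \<open>Quasialgebraicity\<close>

lemma quasialgebraic_space_imp_quasialgebraic_lattice:
  assumes "quasialgebraic_space X"
  shows "quasialgebraic_lattice (closed_sets_lattice X)"
  unfolding quasialgebraic_lattice_def
proof (intro conjI ballI complete_lattice_closed_sets)
  let ?L = "closed_sets_lattice X"
  fix A assume "A \<in> carrier ?L"
  then have A: "closedin X A" by simp
  let ?W = "fin_compact_below ?L A"
  have "pairwise_Un G H \<in> ?W" if "G \<in> ?W" "H \<in> ?W" for G H
  proof -
    have "set_way_below ?L G (pairwise_Un G H)" "set_way_below ?L H (pairwise_Un G H)"
      using that by (auto simp: fin_compact_below_def up_set_pairwise_Un
          intro: set_way_below_mono_right[of _ _ G] set_way_below_mono_right[of _ _ H])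
    with that show ?thesis
      by (simp add: fin_compact_below_def finite_pairwise_Un pairwise_Un_carrier
          up_set_pairwise_Un set_way_below_pairwise_Un)
  qed
  moreover have "{{}} \<in> ?W"
    using A by (simp add: fin_compact_below_def empty_set_way_below up_set_closed_sets_iff)
  ultimately show "directed_wrt (smyth_le ?L) ?W"
    by (intro directed_wrt_smythI) blast+
  have "B \<in> up_set ?L {A}" if B: "\<forall>\<F>\<in>?W. B \<in> up_set ?L \<F>" for B
  proof (rule ccontr)
    have cB: "closedin X B"
      using B \<open>{{}} \<in> ?W\<close> by (auto simp: up_set_closed_sets_iff)
    assume "B \<notin> up_set ?L {A}"
    then obtain x where x: "x \<in> A" "x \<in> topspace X - B"
      using cB closedin_subset[OF A] by (auto simp: up_set_closed_sets_iff)
    then obtain F where F: "finite F" "F \<subseteq> topspace X" "x \<in> spec_up X F"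
        "X interior_of (spec_up X F) = spec_up X F" "spec_up X F \<subseteq> topspace X - B"
      using assms cB unfolding quasialgebraic_space_def
      by (metis (no_types, lifting) openin_diff openin_topspace)
    let ?\<F> = "(\<lambda>x. X closure_of {x}) ` F"
    \<comment> \<open>Openness of \<open>spec_up X F\<close> puts each \<open>f\<close> in
      \<open>F\<close> into the interior, which therefore meets the closure of \<open>{f}\<close>;
      this yields compactness of the family.\<close>
    have "X interior_of (spec_up X F) \<inter> H \<noteq> {}" if "H \<in> ?\<F>" for H
      using that F(2,4) subset_spec_up[OF F(2)] by (force simp: in_closure_of)
    then have "set_way_below ?L ?\<F> ?\<F>"
      by (rule set_way_below_point_closures)
    moreover have "A \<in> up_set ?L ?\<F>"
    proof -
      obtain f where "f \<in> F" "f \<in> A"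
        using F(3) closure_of_singleton_subset[OF A x(1)] by (auto simp: spec_up_iff)
      then show ?thesis
        using A closure_of_singleton_subset[OF A] by (auto simp: up_set_closed_sets_iff)
    qed
    ultimately have "?\<F> \<in> ?W"
      using F(1) by (auto simp: fin_compact_below_def)
    then have "B \<in> up_set ?L ((\<lambda>x. X closure_of {x}) ` F)"
      using B by (rule bspec[rotated])
    then obtain f where "f \<in> F" "X closure_of {f} \<subseteq> B"
      unfolding up_set_closed_sets_iff by blast
    then show False
      using F(2,5) subset_spec_up[OF F(2)] by (force simp: in_closure_of)
  qed
  moreover have "up_set ?L {A} \<subseteq> up_set ?L \<F>" if "\<F> \<in> ?W" for \<F>
    using that by (intro up_set_singleton_subset) (simp add: fin_compact_below_def)
  ultimately show "up_set ?L {A} = (\<Inter>\<F>\<in>?W. up_set ?L \<F>)" by blast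
qed

lemma quasialgebraic_lattice_imp_quasialgebraic_space:
  assumes "quasialgebraic_lattice (closed_sets_lattice X)"
  shows "quasialgebraic_space X"
  unfolding quasialgebraic_space_def
proof (intro allI impI)
  let ?L = "closed_sets_lattice X"
  fix U x assume U: "openin X U \<and> x \<in> U"
  let ?W = "fin_compact_below ?L (X closure_of {x})"
  have "up_set ?L {X closure_of {x}} = (\<Inter>\<F>\<in>?W. up_set ?L \<F>)"
    using assms by (simp add: quasialgebraic_lattice_def)
  moreover have "topspace X - U \<notin> up_set ?L {X closure_of {x}}"
    using U openin_subset[of X U] by (auto simp: up_set_closed_sets_iff in_closure_of subset_iff)
  ultimately obtain \<F> where \<F>: "finite \<F>" "\<And>K. K \<in> \<F> \<Longrightarrow> closedin X K"
      "set_way_below ?L \<F> \<F>" "X closure_of {x} \<in> up_set ?L \<F>" "topspace X - U \<notin> up_set ?L \<F>"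
    unfolding fin_compact_below_def subset_iff carrier_closed_sets by blast
  have U_meets: "U \<inter> K \<noteq> {}" if "K \<in> \<F>" for K
    using that U \<F>(2,5) closedin_subset[of X K] by (auto simp: up_set_closed_sets_iff)
  \<comment> \<open>In contrast to the algebraic case, finitely many points of \<open>K\<close> need
    only generate a set containing some member \<open>K'\<close>, possibly different from
    \<open>K\<close>.\<close>
  have "\<exists>G. finite G \<and> G \<subseteq> K \<and> (\<exists>K'\<in>\<F>. K' \<subseteq> (\<Union>z\<in>G. X closure_of {z}))" if "K \<in> \<F>" for K
    using set_way_below_finite_generators[OF \<F>(3) that, of K] \<F>(2)[OF that]
      closure_of_subset closedin_subset by metis
  then obtain G where G: "\<And>K. K \<in> \<F> \<Longrightarrow>
      finite (G K) \<and> G K \<subseteq> K \<and> (\<exists>K'\<in>\<F>. K' \<subseteq> (\<Union>z\<in>G K. X closure_of {z}))"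
    by metis
  define P where "P = (\<Union>K\<in>\<F>. G K)"
  have "finite P" using \<F>(1) G by (simp add: P_def)
  \<comment> \<open>An open set meeting all of \<open>\<F>\<close> meets \<open>K'\<close>, hence
    contains a generator taken from \<open>K\<close>. So \<open>V \<inter> P\<close> is again a
    transversal of \<open>\<F>\<close>.\<close>
  have open_meets_P: "V \<inter> P \<inter> K \<noteq> {}"
    if V: "openin X V" "\<And>K. K \<in> \<F> \<Longrightarrow> V \<inter> K \<noteq> {}" and K: "K \<in> \<F>" for V K
  proof -
    obtain K' where "K' \<in> \<F>" "K' \<subseteq> (\<Union>z\<in>G K. X closure_of {z})" using G[OF K] by blast
    then obtain z where "z \<in> G K" "z \<in> V"
      using V(2)[of K'] open_meets_closure_singleton[OF V(1)] by blast
    then show ?thesis using G[OF K] K by (auto simp: P_def)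
  qed
  \<comment> \<open>Upper sets of the transversals of \<open>\<F>\<close> drawn from
    \<open>P \<inter> U\<close>; finiteness of \<open>P\<close> provides a minimal one.\<close>
  define \<T> where "\<T> = spec_up X ` {F. F \<subseteq> P \<inter> U \<and> (\<forall>K\<in>\<F>. F \<inter> K \<noteq> {})}"
  have "\<exists>T\<in>\<T>. X interior_of T = T"
  proof (rule ex_open_minimal_upper)
    show "finite \<T>" using \<open>finite P\<close> by (simp add: \<T>_def)
    show "\<T> \<noteq> {}"
      using open_meets_P[of U] U U_meets unfolding \<T>_def by (auto intro!: exI[of _ "U \<inter> P"])
    fix T assume "T \<in> \<T>"
    then obtain F where F: "T = spec_up X F" "F \<subseteq> P \<inter> U" "\<And>K. K \<in> \<F> \<Longrightarrow> F \<inter> K \<noteq> {}"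
      by (auto simp: \<T>_def)
    have "X interior_of T \<inter> K \<noteq> {}" if "K \<in> \<F>" for K
      using set_way_below_interior_meets[OF \<F>(3), of T K] that \<F>(2) F(1,3)
        spec_up_idem[of X F] meets_closed_iff[of X _ F] by blast
    then have "X interior_of T \<inter> P \<inter> K \<noteq> {}" if "K \<in> \<F>" for K
      using open_meets_P[OF openin_interior_of] that by blast
    moreover have "T \<subseteq> U" using spec_up_subset_openin[of X U F] U F by auto
    then have "X interior_of T \<inter> P \<subseteq> P \<inter> U" using interior_of_subset[of X T] by blast
    ultimately have "spec_up X (X interior_of T \<inter> P) \<in> \<T>" by (auto simp: \<T>_def)
    then show "\<exists>T'\<in>\<T>. T' \<subseteq> X interior_of T"
      using spec_up_subset_openin[OF openin_interior_of] by (metis inf_le1)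
  qed
  then obtain F where F: "F \<subseteq> P" "F \<subseteq> U" "\<And>K. K \<in> \<F> \<Longrightarrow> F \<inter> K \<noteq> {}"
      "X interior_of (spec_up X F) = spec_up X F"
    by (auto simp: \<T>_def)
  \<comment> \<open>Some member of \<open>\<F>\<close> lies in the closure of \<open>{x}\<close>,
    and \<open>F\<close> meets it in a point below \<open>x\<close>.\<close>
  have "x \<in> spec_up X F"
    using F(3) \<F>(4) U openin_subset[of X U] by (fastforce simp: spec_up_iff up_set_closed_sets_iff)
  moreover have "finite F" using F(1) \<open>finite P\<close> finite_subset by blast
  moreover have "F \<subseteq> topspace X" using F(2) U openin_subset by blast
  moreover have "spec_up X F \<subseteq> U" using spec_up_subset_openin U F(2) by blast
  ultimately show "\<exists>F. finite F \<and> F \<subseteq> topspace X \<and> x \<in> X interior_of (spec_up X F) \<and>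
      X interior_of (spec_up X F) = spec_up X F \<and> spec_up X F \<subseteq> U"
    using F(4) by auto
qed

theorem theorem4p18:
  fixes X :: "'a topology"
  assumes "t0_space X"
  shows "((continuous_space X \<longleftrightarrow> continuous_lattice (closed_sets_lattice X)) \<and>
          (continuous_lattice (closed_sets_lattice X) \<longleftrightarrow>
             completely_distributive (closed_sets_lattice X))) \<and>
         (quasicontinuous_space X \<longleftrightarrow> quasicontinuous_lattice (closed_sets_lattice X)) \<and>
         (algebraic_space X \<longleftrightarrow> algebraic_lattice (closed_sets_lattice X)) \<and>
         (quasialgebraic_space X \<longleftrightarrow> quasialgebraic_lattice (closed_sets_lattice X))"
  using continuous_space_imp_continuous_lattice continuous_lattice_imp_continuous_space
    continuous_space_imp_completely_distributive completely_distributive_imp_continuous_space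
    quasicontinuous_space_imp_quasicontinuous_lattice quasicontinuous_lattice_imp_quasicontinuous_space
    algebraic_space_imp_algebraic_lattice algebraic_lattice_imp_algebraic_space
    quasialgebraic_space_imp_quasialgebraic_lattice quasialgebraic_lattice_imp_quasialgebraic_space
  by blast

end
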